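(* For every $n\ge1$, there is a bijection between the set of saturated chains of $\Pi_n^\bullet$ starting at $\hat0$ and the set of saturated chains of $\Pi_n^w$ starting at $\hat0$ which preserves label sequences, where chains of $\Pi_n^\bullet$ are labeled by $\lambda_\bullet$ (equivalently $\lambda_{\bullet_2}$) and chains of $\Pi_n^w$ are labeled by $\lambda_w$.
   Context: Pointed partitions: a pointed set is $A^p$ with $A$ nonempty finite, $p\in A$; a pointed partition of $[n]$ is a collection of pointed sets whose underlying sets partition $[n]$. In $\Pi_n^\bullet$, $\pi\lessdot\pi'$ when $\pi'$ arises by replacing two blocks $A^p,B^q$ ($\min A<\min B$) by $(A\cup B)^p$ (a 1-merge) or $(A\cup B)^q$ (a 0-merge); $\hat0$ is the partition into singletons. Both $\lambda_\bullet$ and $\lambda_{\bullet_2}$ assign to a $u$-merge the label $(\min A,\min B)^u$ (they differ only in the partial order put on the label set). Weighted partitions: a weighted set is $A^v$ with $A$ nonempty finite, $v\in\{0,\dots,|A|-1\}$; a weighted partition of $[n]$ is a collection of weighted sets whose underlying sets partition $[n]$. In $\Pi_n^w$, $\pi\lessdot\pi'$ when $\pi'$ arises by replacing two blocks $A^a,B^b$ ($\min A<\min B$) by $(A\cup B)^{a+b+u}$ with $u\in\{0,1\}$; $\hat0=\{1\}^0/\cdots/\{n\}^0$. The labeling $\lambda_w$ assigns to this cover the label $(\min A,\min B)^u$. *)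

theory Defs
  imports Main "HOL-Library.Disjoint_Sets"
begin

text \<open>
  A pointed set \<open>A\<^sup>p\<close> and a weighted set \<open>A\<^sup>v\<close> are both encoded as a pair of the
  underlying set and the decoration.  A collection of such pairs is a pointed (weighted)
  partition when its underlying sets partition \<open>{1..n}\<close>; \<open>inj_on fst\<close> says that no
  underlying set occurs with two different decorations.
\<close>

type_synonym dblock = "nat set \<times> nat"
type_synonym dpart = "dblock set"
type_synonym label = "(nat \<times> nat) \<times> nat"

definition pointed_set :: "dblock \<Rightarrow> bool" where
  "pointed_set X \<longleftrightarrow> finite (fst X) \<and> fst X \<noteq> {} \<and> snd X \<in> fst X"

definition weighted_set :: "dblock \<Rightarrow> bool" where
  "weighted_set X \<longleftrightarrow> finite (fst X) \<and> fst X \<noteq> {} \<and> snd X \<in> {0..card (fst X) - 1}"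

definition decorated_partition :: "nat \<Rightarrow> dpart \<Rightarrow> bool" where
  "decorated_partition n P \<longleftrightarrow> inj_on fst P \<and> partition_on {1..n} (fst ` P)"

definition pointed_partitions :: "nat \<Rightarrow> dpart set" where
  "pointed_partitions n = {P. (\<forall>X\<in>P. pointed_set X) \<and> decorated_partition n P}"

definition weighted_partitions :: "nat \<Rightarrow> dpart set" where
  "weighted_partitions n = {P. (\<forall>X\<in>P. weighted_set X) \<and> decorated_partition n P}"

definition pointed_bot :: "nat \<Rightarrow> dpart" where
  "pointed_bot n = {({i}, i) | i. i \<in> {1..n}}"

definition weighted_bot :: "nat \<Rightarrow> dpart" where
  "weighted_bot n = {({i}, 0) | i. i \<in> {1..n}}"

text \<open>
  \<open>pointed_merge P Q l\<close>: \<open>Q\<close> arises from \<open>P\<close> by a \<open>u\<close>-merge of two blocks, and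
  \<open>l\<close> is \<open>(min A, min B)\<^sup>u\<close>.  Similarly for \<open>weighted_merge\<close>.
\<close>

inductive pointed_merge :: "dpart \<Rightarrow> dpart \<Rightarrow> label \<Rightarrow> bool" where
  one_merge: "\<lbrakk>(A, p) \<in> P; (B, q) \<in> P; Min A < Min B\<rbrakk> \<Longrightarrow>
    pointed_merge P (P - {(A, p), (B, q)} \<union> {(A \<union> B, p)}) ((Min A, Min B), 1)"
| zero_merge: "\<lbrakk>(A, p) \<in> P; (B, q) \<in> P; Min A < Min B\<rbrakk> \<Longrightarrow>
    pointed_merge P (P - {(A, p), (B, q)} \<union> {(A \<union> B, q)}) ((Min A, Min B), 0)"

inductive weighted_merge :: "dpart \<Rightarrow> dpart \<Rightarrow> label \<Rightarrow> bool" where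
  "\<lbrakk>(A, a) \<in> P; (B, b) \<in> P; Min A < Min B; u \<in> {0, 1}\<rbrakk> \<Longrightarrow>
    weighted_merge P (P - {(A, a), (B, b)} \<union> {(A \<union> B, a + b + u)}) ((Min A, Min B), u)"

definition pointed_cover :: "dpart \<Rightarrow> dpart \<Rightarrow> bool" where
  "pointed_cover P Q \<longleftrightarrow> (\<exists>l. pointed_merge P Q l)"

definition weighted_cover :: "dpart \<Rightarrow> dpart \<Rightarrow> bool" where
  "weighted_cover P Q \<longleftrightarrow> (\<exists>l. weighted_merge P Q l)"

text \<open>
  The label is determined by the cover: see \<open>pointed_merge_label_unique\<close> and
  \<open>weighted_merge_label_unique\<close> below.  Only the label itself matters for label
  sequences, so \<open>pointed_label\<close> is both \<open>\<lambda>\<^sub>\<bullet>\<close> and its variant with another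
  partial order on the labels.
\<close>

definition pointed_label :: "dpart \<Rightarrow> dpart \<Rightarrow> label" where
  "pointed_label P Q = (THE l. pointed_merge P Q l)"

definition weighted_label :: "dpart \<Rightarrow> dpart \<Rightarrow> label" where
  "weighted_label P Q = (THE l. weighted_merge P Q l)"

text \<open>
  A saturated chain \<open>x\<^sub>0 \<lessdot> x\<^sub>1 \<lessdot> \<dots> \<lessdot> x\<^sub>k\<close> is the list of its elements in increasing
  order.  The length \<open>k \<ge> 0\<close> is arbitrary; the chain need not be maximal.
\<close>

definition saturated_chains_from :: "'a set \<Rightarrow> ('a \<Rightarrow> 'a \<Rightarrow> bool) \<Rightarrow> 'a \<Rightarrow> 'a list set" where
  "saturated_chains_from S cov x =
    {c. c \<noteq> [] \<and> hd c = x \<and> set c \<subseteq> S \<and> successively cov c}"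

definition label_sequence :: "('a \<Rightarrow> 'a \<Rightarrow> 'l) \<Rightarrow> 'a list \<Rightarrow> 'l list" where
  "label_sequence lab c = map2 lab c (tl c)"

lemma merge_removed_blocks:
  assumes "decorated_partition n P" "(A, a) \<in> P" "(B, b) \<in> P" "Min A < Min B"
    and "Q = P - {(A, a), (B, b)} \<union> {(A \<union> B, c)}"
  shows "P - Q = {(A, a), (B, b)}" "Q - P = {(A \<union> B, c)}" "A \<inter> B = {}"
proof -
  have part: "partition_on {1..n} (fst ` P)"
    using assms(1) by (simp add: decorated_partition_def)
  have disj: "X = Y \<or> X \<inter> Y = {}" if "X \<in> fst ` P" "Y \<in> fst ` P" for X Y
    using part that by (auto simp: partition_on_def disjoint_def)
  have ne: "X \<noteq> {}" if "X \<in> fst ` P" for X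
    using part that by (auto simp: partition_on_def)
  have A: "A \<in> fst ` P" and B: "B \<in> fst ` P"
    using assms(2,3) by force+
  show AB: "A \<inter> B = {}"
    using disj[OF A B] assms(4) by auto
  have "A \<union> B \<notin> fst ` P"
  proof
    assume "A \<union> B \<in> fst ` P"
    from disj[OF this A] disj[OF this B] ne[OF A] ne[OF B] AB show False by auto
  qed
  then have "(A \<union> B, c) \<notin> P" by force
  then show "P - Q = {(A, a), (B, b)}" "Q - P = {(A \<union> B, c)}"
    using assms(2,3,5) by auto
qed

lemma pointed_merge_label_unique:
  assumes P: "P \<in> pointed_partitions n" and "pointed_merge P Q l" "pointed_merge P Q l'"
  shows "l = l'"
proof -
  have dp: "decorated_partition n P" and pt: "\<And>A p. (A, p) \<in> P \<Longrightarrow> p \<in> A"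
    using P by (auto simp: pointed_partitions_def pointed_set_def)
  have key: "\<exists>A p B q. P - Q = {(A, p), (B, q)} \<and> Min A < Min B \<and> p \<noteq> q \<and>
      (l = ((Min A, Min B), 1) \<and> Q - P = {(A \<union> B, p)} \<or>
       l = ((Min A, Min B), 0) \<and> Q - P = {(A \<union> B, q)})" if "pointed_merge P Q l" for l
    using that
  proof cases
    case (one_merge A p B q)
    note rem = merge_removed_blocks[OF dp one_merge(3,4,5,1)]
    have "p \<noteq> q"
      using rem(3) pt[OF one_merge(3)] pt[OF one_merge(4)] by auto
    then show ?thesis
      using rem(1,2) one_merge(2,5) by metis
  next
    case (zero_merge A p B q)
    note rem = merge_removed_blocks[OF dp zero_merge(3,4,5,1)]
    have "p \<noteq> q"
      using rem(3) pt[OF zero_merge(3)] pt[OF zero_merge(4)] by auto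
    then show ?thesis
      using rem(1,2) zero_merge(2,5) by metis
  qed
  obtain A p B q where 1: "P - Q = {(A, p), (B, q)}" "Min A < Min B" "p \<noteq> q"
      "l = ((Min A, Min B), 1) \<and> Q - P = {(A \<union> B, p)} \<or>
       l = ((Min A, Min B), 0) \<and> Q - P = {(A \<union> B, q)}"
    using key[OF assms(2)] by (elim exE conjE) (rule that)
  obtain A' p' B' q' where 2: "P - Q = {(A', p'), (B', q')}" "Min A' < Min B'" "p' \<noteq> q'"
      "l' = ((Min A', Min B'), 1) \<and> Q - P = {(A' \<union> B', p')} \<or>
       l' = ((Min A', Min B'), 0) \<and> Q - P = {(A' \<union> B', q')}"
    using key[OF assms(3)] by (elim exE conjE) (rule that)
  have "{(A, p), (B, q)} = {(A', p'), (B', q')}"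
    using 1(1) 2(1) by simp
  then have "A = A'" "p = p'" "B = B'" "q = q'"
    using 1(2) 2(2) by (auto simp: doubleton_eq_iff)
  with 1(3,4) 2(4) show ?thesis
    by (elim disjE conjE) simp_all
qed

lemma weighted_merge_label_unique:
  assumes P: "P \<in> weighted_partitions n" and "weighted_merge P Q l" "weighted_merge P Q l'"
  shows "l = l'"
proof -
  have dp: "decorated_partition n P"
    using P by (auto simp: weighted_partitions_def)
  have key: "\<exists>A a B b u. P - Q = {(A, a), (B, b)} \<and> Min A < Min B \<and>
      l = ((Min A, Min B), u) \<and> Q - P = {(A \<union> B, a + b + u)}" if "weighted_merge P Q l" for l
    using that
  proof cases
    case (1 A a B b u)
    show ?thesis
      using merge_removed_blocks(1,2)[OF dp 1(3,4,5,1)] 1(2,5) by metis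
  qed
  obtain A a B b u where 1: "P - Q = {(A, a), (B, b)}" "Min A < Min B"
      "l = ((Min A, Min B), u)" "Q - P = {(A \<union> B, a + b + u)}"
    using key[OF assms(2)] by (elim exE conjE) (rule that)
  obtain A' a' B' b' u' where 2: "P - Q = {(A', a'), (B', b')}" "Min A' < Min B'"
      "l' = ((Min A', Min B'), u')" "Q - P = {(A' \<union> B', a' + b' + u')}"
    using key[OF assms(3)] by (elim exE conjE) (rule that)
  have "{(A, a), (B, b)} = {(A', a'), (B', b')}"
    using 1(1) 2(1) by simp
  then have "A = A'" "a = a'" "B = B'" "b = b'"
    using 1(2) 2(2) by (auto simp: doubleton_eq_iff)
  with 1(3,4) 2(3,4) show ?thesis
    by simp
qed

end

theory Submission
  imports Defs
begin

text \<open>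
  In both posets the label \<open>(min A, min B)\<^sup>u\<close> identifies the two blocks to be merged and the
  rule for the new decoration, so a saturated chain from a fixed start is determined by its label
  sequence. Which labels are available depends only on the underlying set partition, and a merge
  acts on it in the same way in both posets; hence both posets have the same label sequences.
\<close>

section \<open>Chains and their label sequences\<close>

text \<open>Equal first labels force equal second elements, so the two tails again start at a common
  element; hence the induction generalises the start \<open>x\<close> together with
  \<open>d\<close>.\<close>

lemma inj_on_label_sequence:
  assumes det: "\<And>x y z. \<lbrakk>x \<in> S; cov x y; cov x z; lab x y = lab x z\<rbrakk> \<Longrightarrow> y = z"
  shows "inj_on (label_sequence lab) (saturated_chains_from S cov x)"
proof (rule inj_onI)
  fix c d
  assume "c \<in> saturated_chains_from S cov x" "d \<in> saturated_chains_from S cov x"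
    and "label_sequence lab c = label_sequence lab d"
  then show "c = d"
  proof (induction c arbitrary: d x)
    case Nil
    then show ?case by (simp add: saturated_chains_from_def)
  next
    case (Cons a c)
    obtain d' where d: "d = a # d'" and a: "a \<in> S"
      using Cons.prems by (cases d) (auto simp: saturated_chains_from_def)
    show ?case
    proof (cases c)
      case Nil
      \<comment> \<open>A one-element chain has no labels, whereas a nonempty \<open>d'\<close>
        would produce one.\<close>
      then show ?thesis
        using Cons.prems(3) d by (cases d') (auto simp: label_sequence_def)
    next
      case c: (Cons b c')
      then obtain e d'' where d': "d' = e # d''"
        using Cons.prems(3) d by (cases d') (auto simp: label_sequence_def)
      have "lab a b = lab a e" "label_sequence lab c = label_sequence lab d'"
        using Cons.prems(3) c d d' by (simp_all add: label_sequence_def)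
      moreover have "cov a b" "cov a e"
        using Cons.prems(1,2) c d d' by (auto simp: saturated_chains_from_def)
      ultimately have "b = e"
        using det a by blast
      then have "c \<in> saturated_chains_from S cov b" "d' \<in> saturated_chains_from S cov b"
        using Cons.prems(1,2) c d d' by (simp_all add: saturated_chains_from_def)
      then show ?thesis
        using Cons.IH \<open>label_sequence lab c = label_sequence lab d'\<close> d by blast
    qed
  qed
qed

text \<open>\<open>R\<close> is a one-way simulation: answering a chain cover by cover, always from
  the related element just reached, copies its label sequence. Used in both directions, this gives
  equality of the two sets of sequences.\<close>

lemma label_sequences_simulation:
  assumes sim: "\<And>x y x'. \<lbrakk>x \<in> S; y \<in> T; R x y; x' \<in> S; cov x x'\<rbrakk> \<Longrightarrow>
      \<exists>y'\<in>T. cov' y y' \<and> lab' y y' = lab x x' \<and> R x' y'"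
    and "y \<in> T" "R x y"
  shows "label_sequence lab ` saturated_chains_from S cov x
    \<subseteq> label_sequence lab' ` saturated_chains_from T cov' y"
proof -
  have "\<exists>d \<in> saturated_chains_from T cov' y. label_sequence lab' d = label_sequence lab c"
    if "c \<in> saturated_chains_from S cov x" for c
    using that assms(2,3)
  proof (induction c arbitrary: x y)
    case Nil
    then show ?case by (simp add: saturated_chains_from_def)
  next
    case (Cons a c)
    show ?case
    proof (cases c)
      case Nil
      have "[y] \<in> saturated_chains_from T cov' y"
        using Cons.prems by (simp add: saturated_chains_from_def)
      then show ?thesis
        using Nil by (intro bexI) (auto simp: label_sequence_def)
    next
      case c: (Cons b c')
      have "cov a b" and a: "a = x" "a \<in> S" "b \<in> S" and cb: "c \<in> saturated_chains_from S cov b"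
        using Cons.prems(1) c by (auto simp: saturated_chains_from_def)
      with sim Cons.prems obtain y' where
        y': "y' \<in> T" "cov' y y'" "lab' y y' = lab a b" "R b y'" by blast
      with Cons.IH[OF cb] obtain d where
        d: "d \<in> saturated_chains_from T cov' y'" "label_sequence lab' d = label_sequence lab c"
        by blast
      \<comment> \<open>Exposing the head of \<open>d\<close> allows the cover from \<open>y\<close>
        to \<open>y'\<close> and its label to be put in front.\<close>
      obtain d' where d': "d = y' # d'"
        using d(1) by (cases d) (auto simp: saturated_chains_from_def)
      have "y # d \<in> saturated_chains_from T cov' y"
        using d(1) d' y' Cons.prems(2) by (simp add: saturated_chains_from_def)
      moreover have "label_sequence lab' (y # d) = label_sequence lab (a # c)"
        using d(2) d' c y'(3) by (simp add: label_sequence_def)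
      ultimately show ?thesis by blast
    qed
  qed
  then show ?thesis by (force simp: image_iff)
qed

section \<open>Merges with an arbitrary decoration rule\<close>

definition decorated_partitions :: "(dblock \<Rightarrow> bool) \<Rightarrow> nat \<Rightarrow> dpart set" where
  "decorated_partitions D n = {P. (\<forall>X\<in>P. D X) \<and> decorated_partition n P}"

text \<open>\<open>g u a b\<close> is the decoration of the merged block. The two merge relations
  differ only in this rule, so determinism and simulation can be proved once for all
  \<open>g\<close>.\<close>

definition merge :: "(nat \<Rightarrow> nat \<Rightarrow> nat \<Rightarrow> nat) \<Rightarrow> dpart \<Rightarrow> dpart \<Rightarrow> label \<Rightarrow> bool" where
  "merge g P Q l \<longleftrightarrow> (\<exists>A a B b u. (A, a) \<in> P \<and> (B, b) \<in> P \<and> Min A < Min B \<and> u \<in> {0, 1} \<and>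
    Q = P - {(A, a), (B, b)} \<union> {(A \<union> B, g u a b)} \<and> l = ((Min A, Min B), u))"

text \<open>This ensures that a merge with a prescribed label never leaves the poset, so that it can
  always be carried out in answer to a merge in the other poset.\<close>

definition merge_closed :: "(nat \<Rightarrow> nat \<Rightarrow> nat \<Rightarrow> nat) \<Rightarrow> (dblock \<Rightarrow> bool) \<Rightarrow> bool" where
  "merge_closed g D \<longleftrightarrow> (\<forall>A a B b u. D (A, a) \<longrightarrow> D (B, b) \<longrightarrow> A \<inter> B = {} \<longrightarrow> u \<in> {0, 1} \<longrightarrow>
    D (A \<union> B, g u a b))"

lemma pointed_merge_eq: "pointed_merge = merge (\<lambda>u p q. if u = 1 then p else q)"
proof (intro ext iffI)
  fix P Q l
  assume "pointed_merge P Q l"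
  then show "merge (\<lambda>u p q. if u = 1 then p else q) P Q l"
  proof cases
    case (one_merge A p B q)
    then show ?thesis
      unfolding merge_def
      by (intro exI[of _ A] exI[of _ p] exI[of _ B] exI[of _ q] exI[of _ 1]) simp
  next
    case (zero_merge A p B q)
    then show ?thesis
      unfolding merge_def
      by (intro exI[of _ A] exI[of _ p] exI[of _ B] exI[of _ q] exI[of _ 0]) simp
  qed
next
  fix P Q l
  assume "merge (\<lambda>u p q. if u = 1 then p else q) P Q l"
  then obtain A p B q and u :: nat where "(A, p) \<in> P" "(B, q) \<in> P" "Min A < Min B" "u \<in> {0, 1}"
    "Q = P - {(A, p), (B, q)} \<union> {(A \<union> B, if u = 1 then p else q)}" "l = ((Min A, Min B), u)"
    unfolding merge_def by (elim exE conjE)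
  then show "pointed_merge P Q l"
    using one_merge[of A p P B q] zero_merge[of A p P B q] by (cases "u = 1") simp_all
qed

lemma weighted_merge_eq: "weighted_merge = merge (\<lambda>u a b. a + b + u)"
  unfolding merge_def weighted_merge.simps fun_eq_iff by (intro allI) blast

lemma merge_closed_pointed: "merge_closed (\<lambda>u p q. if u = 1 then p else q) pointed_set"
  by (auto simp: merge_closed_def pointed_set_def)

text \<open>The largest possible new weight is \<open>(card A - 1) + (card B - 1) + 1\<close>, which
  for disjoint nonempty blocks is exactly \<open>card (A \<union> B) - 1\<close>.\<close>

lemma merge_closed_weighted: "merge_closed (\<lambda>u a b. a + b + u) weighted_set"
proof -
  have "a + b + u \<le> card (A \<union> B) - 1"
    if "finite A" "A \<noteq> {}" "a \<le> card A - 1" "finite B" "B \<noteq> {}" "b \<le> card B - 1"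
      "A \<inter> B = {}" "u \<le> 1" for a b u :: nat and A B :: "nat set"
  proof -
    \<comment> \<open>Positive cardinalities keep the subtractions on the naturals from being
      truncated.\<close>
    have "0 < card A" "0 < card B"
      using that by (auto simp: card_gt_0_iff)
    then show ?thesis
      using that by (simp add: card_Un_disjoint)
  qed
  then show ?thesis
    by (fastforce simp: merge_closed_def weighted_set_def)
qed

section \<open>Effect of a merge on blocks and decorations\<close>

text \<open>Finite nonempty blocks contain their minimum, so a shared minimum makes two blocks meet
  and hence coincide; injectivity of \<open>fst\<close> then fixes the decoration.\<close>

lemma decorated_partition_Min_inj:
  assumes P: "decorated_partition n P" and "(A, a) \<in> P" "(B, b) \<in> P" "Min A = Min B"
  shows "A = B \<and> a = b"
proof -
  have part: "partition_on {1..n} (fst ` P)"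
    using P by (simp add: decorated_partition_def)
  have AB: "A \<in> fst ` P" "B \<in> fst ` P"
    using assms(2,3) by force+
  have "A \<subseteq> {1..n}" "B \<subseteq> {1..n}"
    using partition_onD1[OF part] AB by blast+
  then have "finite A" "finite B"
    by (simp_all add: finite_subset)
  moreover have "A \<noteq> {}" "B \<noteq> {}"
    using part AB by (auto simp: partition_on_def)
  ultimately have "Min A \<in> A \<inter> B"
    using assms(4) Min_in by (metis IntI)
  then have "A = B"
    using part AB by (auto simp: partition_on_def disjoint_def)
  then show ?thesis
    using P assms(2,3) inj_onD[of fst P "(A, a)" "(B, b)"] by (simp add: decorated_partition_def)
qed

text \<open>The minima in \<open>l\<close> identify both blocks together with their decorations, and
  the last entry of \<open>l\<close> selects the rule \<open>g u\<close>.\<close>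

lemma merge_deterministic:
  assumes "decorated_partition n P" "merge g P Q l" "merge g P Q' l"
  shows "Q = Q'"
proof -
  obtain A a B b u where AB: "(A, a) \<in> P" "(B, b) \<in> P" "l = ((Min A, Min B), u)"
    and Q: "Q = P - {(A, a), (B, b)} \<union> {(A \<union> B, g u a b)}"
    using assms(2) unfolding merge_def by (elim exE conjE)
  obtain A' a' B' b' u' where AB': "(A', a') \<in> P" "(B', b') \<in> P" "l = ((Min A', Min B'), u')"
    and Q': "Q' = P - {(A', a'), (B', b')} \<union> {(A' \<union> B', g u' a' b')}"
    using assms(3) unfolding merge_def by (elim exE conjE)
  have "Min A = Min A'" "Min B = Min B'" "u = u'"
    using AB(3) AB'(3) by simp_all
  then show ?thesis
    unfolding Q Q'
    using decorated_partition_Min_inj[OF assms(1) AB(1) AB'(1)]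
      decorated_partition_Min_inj[OF assms(1) AB(2) AB'(2)] by simp
qed

text \<open>The right-hand side contains no decoration: a merge acts on the underlying partition
  independently of them. Injectivity of \<open>fst\<close> lets the image commute with the set
  difference.\<close>

lemma fst_image_merged:
  assumes "decorated_partition n P" "(A, a) \<in> P" "(B, b) \<in> P"
  shows "fst ` (P - {(A, a), (B, b)} \<union> {(A \<union> B, c)}) = fst ` P - {A, B} \<union> {A \<union> B}"
proof -
  have "inj_on fst P"
    using assms(1) by (simp add: decorated_partition_def)
  then have "fst ` (P - {(A, a), (B, b)}) = fst ` P - fst ` {(A, a), (B, b)}"
    using assms(2,3) by (intro inj_on_image_set_diff) auto
  then show ?thesis
    by (simp add: image_Un)
qed

lemma merged_in_decorated_partitions:
  assumes closed: "merge_closed g D" and P: "P \<in> decorated_partitions D n"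
    and AB: "(A, a) \<in> P" "(B, b) \<in> P" "Min A < Min B" and u: "u \<in> {0, 1}"
  shows "P - {(A, a), (B, b)} \<union> {(A \<union> B, g u a b)} \<in> decorated_partitions D n"
    (is "?Q \<in> _")
proof -
  have dp: "decorated_partition n P" and D: "\<forall>X\<in>P. D X"
    using P by (auto simp: decorated_partitions_def)
  have part: "partition_on {1..n} (fst ` P)" and inj: "inj_on fst P"
    using dp by (auto simp: decorated_partition_def)
  have AB': "A \<in> fst ` P" "B \<in> fst ` P"
    using AB by force+
  have disj: "X = Y \<or> X \<inter> Y = {}" if "X \<in> fst ` P" "Y \<in> fst ` P" for X Y
    using part that by (auto simp: partition_on_def disjoint_def)
  have ne: "X \<noteq> {}" if "X \<in> fst ` P" for X
    using part that by (auto simp: partition_on_def)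
  have dAB: "A \<inter> B = {}"
    using disj[OF AB'] AB(3) by auto
  \<comment> \<open>A block \<open>A \<union> B\<close> would meet, and hence equal, both of the
    disjoint blocks \<open>A\<close> and \<open>B\<close>. As the union is new, adding it preserves
    injectivity of \<open>fst\<close>.\<close>
  have "A \<union> B \<notin> fst ` P"
  proof
    assume "A \<union> B \<in> fst ` P"
    from disj[OF this AB'(1)] disj[OF this AB'(2)] ne[OF AB'(1)] ne[OF AB'(2)] dAB
    show False by auto
  qed
  then have "inj_on fst ?Q"
    using inj by (auto simp: inj_on_def image_iff)
  moreover have "partition_on {1..n} (fst ` ?Q)"
  proof -
    have "\<Union>(fst ` P - {A, B} \<union> {A \<union> B}) = \<Union>(fst ` P)"
      using AB' by auto
    also have "\<dots> = {1..n}"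
      using part by (simp add: partition_on_def)
    finally have "\<Union>(fst ` P - {A, B} \<union> {A \<union> B}) = {1..n}" .
    moreover have "disjoint (fst ` P - {A, B} \<union> {A \<union> B})"
    proof -
      have "X \<inter> (A \<union> B) = {}" if "X \<in> fst ` P - {A, B}" for X
        using disj[of X A] disj[of X B] that AB' by auto
      moreover have "disjoint (fst ` P - {A, B})"
        using part by (auto simp: partition_on_def disjoint_def)
      ultimately show ?thesis
        unfolding disjoint_def by (metis UnE inf_commute singletonD)
    qed
    moreover have "{} \<notin> fst ` P - {A, B} \<union> {A \<union> B}"
      using ne AB' by auto
    ultimately show ?thesis
      unfolding fst_image_merged[OF dp AB(1,2)] partition_on_def by blast
  qed
  moreover have "D (A \<union> B, g u a b)"
    using closed D AB u dAB unfolding merge_closed_def by blast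
  ultimately show ?thesis
    using D by (auto simp: decorated_partitions_def decorated_partition_def)
qed

text \<open>A merge and its label are available as soon as two blocks with distinct minima are
  present, whatever their decorations. So \<open>W\<close> can merge \<open>A\<close> and
  \<open>B\<close> with the decorations they carry there; closure keeps the result admissible, and
  the underlying partitions stay equal.\<close>

lemma merge_simulation:
  assumes P: "P \<in> decorated_partitions D n" and W: "W \<in> decorated_partitions D' n"
    and eq: "fst ` P = fst ` W" and closed: "merge_closed g' D'" and m: "merge g P P' l"
  shows "\<exists>W'\<in>decorated_partitions D' n. merge g' W W' l \<and> fst ` P' = fst ` W'"
proof -
  obtain A a B b u where AB: "(A, a) \<in> P" "(B, b) \<in> P" and lt: "Min A < Min B" and u: "u \<in> {0, 1}"
    and P': "P' = P - {(A, a), (B, b)} \<union> {(A \<union> B, g u a b)}" and l: "l = ((Min A, Min B), u)"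
    using m unfolding merge_def by (elim exE conjE)
  have "A \<in> fst ` W" "B \<in> fst ` W"
    unfolding eq[symmetric] using AB by force+
  then obtain a' b' where W_AB: "(A, a') \<in> W" "(B, b') \<in> W"
    by auto
  define W' where "W' = W - {(A, a'), (B, b')} \<union> {(A \<union> B, g' u a' b')}"
  have "W' \<in> decorated_partitions D' n"
    unfolding W'_def using merged_in_decorated_partitions[OF closed W W_AB lt u] .
  moreover have "merge g' W W' l"
    unfolding merge_def W'_def l using W_AB lt u by blast
  moreover have "fst ` P' = fst ` W'"
  proof -
    have "decorated_partition n P" "decorated_partition n W"
      using P W by (simp_all add: decorated_partitions_def)
    then show ?thesis
      unfolding P' W'_def using fst_image_merged AB W_AB eq by metis
  qed
  ultimately show ?thesis by blast
qed

section \<open>Pointed and weighted partitions as instances\<close>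

lemma pointed_partitions_eq: "pointed_partitions n = decorated_partitions pointed_set n"
  by (simp add: pointed_partitions_def decorated_partitions_def)

lemma weighted_partitions_eq: "weighted_partitions n = decorated_partitions weighted_set n"
  by (simp add: weighted_partitions_def decorated_partitions_def)

text \<open>Uniqueness of labels turns the definite description in \<open>pointed_label\<close> into
  the label of any given merge.\<close>

lemma pointed_label_eq:
  "\<lbrakk>P \<in> pointed_partitions n; pointed_merge P Q l\<rbrakk> \<Longrightarrow> pointed_label P Q = l"
  unfolding pointed_label_def using pointed_merge_label_unique by blast

lemma weighted_label_eq:
  "\<lbrakk>P \<in> weighted_partitions n; weighted_merge P Q l\<rbrakk> \<Longrightarrow> weighted_label P Q = l"
  unfolding weighted_label_def using weighted_merge_label_unique by blast

text \<open>\<open>h\<close> is the identity for the pointed bottom element and constantly 0 for the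
  weighted one, so both lie over the same set partition.\<close>

lemma fst_image_singletons:
  "fst ` {({i}, h i) | i. i \<in> {1..n}} = (\<lambda>i. {i}) ` {1..n}" for h :: "nat \<Rightarrow> nat"
  by force

lemma singletons_in_decorated_partitions:
  assumes "\<And>i. D ({i}, h i)"
  shows "{({i}, h i) | i. i \<in> {1..n}} \<in> decorated_partitions D n"
proof -
  have "partition_on {1..n} (fst ` {({i}, h i) | i. i \<in> {1..n}})"
    unfolding fst_image_singletons by (rule partition_onI) (auto simp: disjnt_def)
  moreover have "inj_on fst {({i}, h i) | i. i \<in> {1..n}}"
    by (auto intro: inj_onI)
  ultimately show ?thesis
    using assms unfolding decorated_partitions_def decorated_partition_def by blast
qed

lemma pointed_bot_in: "pointed_bot n \<in> pointed_partitions n"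
  unfolding pointed_bot_def pointed_partitions_eq
  by (rule singletons_in_decorated_partitions) (simp add: pointed_set_def)

lemma weighted_bot_in: "weighted_bot n \<in> weighted_partitions n"
  unfolding weighted_bot_def weighted_partitions_eq
  by (rule singletons_in_decorated_partitions) (simp add: weighted_set_def)

lemma fst_image_bot: "fst ` pointed_bot n = fst ` weighted_bot n"
  unfolding pointed_bot_def weighted_bot_def fst_image_singletons ..

section \<open>Comparison of the label sequences of the two posets\<close>

lemma inj_on_pointed_label_sequence:
  "inj_on (label_sequence pointed_label)
    (saturated_chains_from (pointed_partitions n) pointed_cover x)"
proof (rule inj_on_label_sequence)
  fix P Q Q'
  assume P: "P \<in> pointed_partitions n" and "pointed_cover P Q" "pointed_cover P Q'"
    and "pointed_label P Q = pointed_label P Q'"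
  \<comment> \<open>Each cover comes from some merge; as the label functions return the labels of
    these merges, their equality gives a common \<open>l\<close>.\<close>
  then obtain l where "pointed_merge P Q l" "pointed_merge P Q' l"
    using pointed_label_eq unfolding pointed_cover_def by metis
  then show "Q = Q'"
    using merge_deterministic P unfolding pointed_merge_eq pointed_partitions_def by blast
qed

lemma inj_on_weighted_label_sequence:
  "inj_on (label_sequence weighted_label)
    (saturated_chains_from (weighted_partitions n) weighted_cover x)"
proof (rule inj_on_label_sequence)
  fix P Q Q'
  assume P: "P \<in> weighted_partitions n" and "weighted_cover P Q" "weighted_cover P Q'"
    and "weighted_label P Q = weighted_label P Q'"
  then obtain l where "weighted_merge P Q l" "weighted_merge P Q' l"
    using weighted_label_eq unfolding weighted_cover_def by metis
  then show "Q = Q'"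
    using merge_deterministic P unfolding weighted_merge_eq weighted_partitions_def by blast
qed

text \<open>Having the same underlying set partition is a simulation in both directions, and it
  relates the two bottom elements.\<close>

lemma label_sequences_eq:
  "label_sequence pointed_label `
      saturated_chains_from (pointed_partitions n) pointed_cover (pointed_bot n) =
    label_sequence weighted_label `
      saturated_chains_from (weighted_partitions n) weighted_cover (weighted_bot n)"
proof (rule antisym)
  show "label_sequence pointed_label `
      saturated_chains_from (pointed_partitions n) pointed_cover (pointed_bot n) \<subseteq>
    label_sequence weighted_label `
      saturated_chains_from (weighted_partitions n) weighted_cover (weighted_bot n)"
  proof (rule label_sequences_simulation[where R = "\<lambda>P W. fst ` P = fst ` W"])
    fix P W P'
    assume P: "P \<in> pointed_partitions n" and W: "W \<in> weighted_partitions n"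
      and eq: "fst ` P = fst ` W" and "pointed_cover P P'"
    then obtain l where l: "pointed_merge P P' l"
      by (auto simp: pointed_cover_def)
    then obtain W' where "W' \<in> weighted_partitions n" "weighted_merge W W' l" "fst ` P' = fst ` W'"
      using merge_simulation[OF _ _ eq merge_closed_weighted] P W
      unfolding pointed_partitions_eq weighted_partitions_eq pointed_merge_eq weighted_merge_eq
      by blast
    then show "\<exists>W'\<in>weighted_partitions n. weighted_cover W W' \<and>
        weighted_label W W' = pointed_label P P' \<and> fst ` P' = fst ` W'"
      using pointed_label_eq[OF P l] weighted_label_eq[OF W] unfolding weighted_cover_def by blast
  qed (fact weighted_bot_in fst_image_bot)+
next
  show "label_sequence weighted_label `
      saturated_chains_from (weighted_partitions n) weighted_cover (weighted_bot n) \<subseteq>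
    label_sequence pointed_label `
      saturated_chains_from (pointed_partitions n) pointed_cover (pointed_bot n)"
  proof (rule label_sequences_simulation[where R = "\<lambda>W P. fst ` W = fst ` P"])
    fix W P W'
    assume W: "W \<in> weighted_partitions n" and P: "P \<in> pointed_partitions n"
      and eq: "fst ` W = fst ` P" and "weighted_cover W W'"
    then obtain l where l: "weighted_merge W W' l"
      by (auto simp: weighted_cover_def)
    then obtain P' where "P' \<in> pointed_partitions n" "pointed_merge P P' l" "fst ` W' = fst ` P'"
      using merge_simulation[OF _ _ eq merge_closed_pointed] P W
      unfolding pointed_partitions_eq weighted_partitions_eq pointed_merge_eq weighted_merge_eq
      by blast
    then show "\<exists>P'\<in>pointed_partitions n. pointed_cover P P' \<and>
        pointed_label P P' = weighted_label W W' \<and> fst ` W' = fst ` P'"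
      using weighted_label_eq[OF W l] pointed_label_eq[OF P] unfolding pointed_cover_def by blast
  qed (fact pointed_bot_in fst_image_bot[symmetric])+
qed

theorem theorem4p5:
  fixes n :: nat
  assumes "n \<ge> 1"
  shows "\<exists>f. bij_betw f
      (saturated_chains_from (pointed_partitions n) pointed_cover (pointed_bot n))
      (saturated_chains_from (weighted_partitions n) weighted_cover (weighted_bot n)) \<and>
    (\<forall>c \<in> saturated_chains_from (pointed_partitions n) pointed_cover (pointed_bot n).
      label_sequence weighted_label (f c) = label_sequence pointed_label c)"
proof -
  let ?C = "saturated_chains_from (pointed_partitions n) pointed_cover (pointed_bot n)"
  let ?W = "saturated_chains_from (weighted_partitions n) weighted_cover (weighted_bot n)"
  \<comment> \<open>The bijection sends a pointed chain to the unique weighted chain with the same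
    label sequence; \<open>?g\<close> recovers a weighted chain from its sequence.\<close>
  let ?g = "inv_into ?W (label_sequence weighted_label)"
  let ?I = "label_sequence weighted_label ` ?W"
  have "bij_betw (label_sequence pointed_label) ?C ?I"
    using inj_on_pointed_label_sequence label_sequences_eq by (simp add: bij_betw_def)
  moreover have "bij_betw ?g ?I ?W"
    using inj_on_weighted_label_sequence by (intro bij_betw_inv_into) (simp add: bij_betw_def)
  ultimately have "bij_betw (?g \<circ> label_sequence pointed_label) ?C ?W"
    by (rule bij_betw_trans)
  \<comment> \<open>Since the two sets of label sequences agree, the sequence of \<open>c\<close>
    lies in \<open>?I\<close>, where applying \<open>?g\<close> and then reading off labels gives it
    back.\<close>
  moreover have "label_sequence weighted_label ((?g \<circ> label_sequence pointed_label) c) =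
      label_sequence pointed_label c" if "c \<in> ?C" for c
    using that label_sequences_eq[of n] by (auto intro!: f_inv_into_f)
  ultimately show ?thesis by blast
qed

end
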